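(* Let $(M,d)$ be a metric space, $X,Y\in\mathrm{Ran}(M)$ two configurations, and $\omega$ a weight. Then $$d^\omega(X,Y)=\inf\{\ell^\omega(R_0,\dots,R_{k-1})\}$$ where the infimum is taken over simple MBS-chains $(R_0,\dots,R_{k-1})$ between $X$ and $Y$.
   Context: $\mathrm{Ran}(M)$ is the set of non-empty finite subsets of $M$ (called configurations). A weight is a non-decreasing function $\omega\colon\{1,2,3,\dots\}\to[1,\infty)$ with $\omega(1)=1$. For $X,Y\in\mathrm{Ran}(M)$, a surjective relation from $X$ to $Y$ is a subset $R\subset X\times Y$ such that every $x\in X$ is related to at least one $y\in Y$ and every $y\in Y$ is related to at least one $x\in X$; its $\omega$-length is $\ell^\omega(R)=\omega(\mathrm{card}(R))\sum_{(x,y)\in R}d(x,y)$, where $\mathrm{card}(R)$ is the number of pairs in $R$. A combinatorial chain from $X$ to $Y$ consists of configurations $X=X_0,X_1,\dots,X_k=Y$ ($k\ge 0$) and surjective relations $R_j$ from $X_j$ to $X_{j+1}$, $0\le j\le k-1$; its $\omega$-length is $\ell^\omega(R_0,\dots,R_{k-1})=\sum_{j=0}^{k-1}\ell^\omega(R_j)$. The weighted distance $d^\omega(X,Y)$ is the infimum of the $\omega$-lengths of all combinatorial chains from $X$ to $Y$. A surjective relation $R$ from $X$ to $Y$ is a merge if it is the graph of a map $f\colon X\to Y$ for which there is $y_0\in Y$ with $\mathrm{card}(f^{-1}(y_0))\ge 2$ and $f^{-1}(y)=\{y\}$ (as a subset of $X$) for all $y\ne y_0$; the merge is simple if $\mathrm{card}(f^{-1}(y_0))=2$.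 It is a bijection if it is the graph of a bijection $X\to Y$. It is a (simple) splitting if the opposite relation $R^{\mathrm{op}}\subset Y\times X$ is a (simple) merge from $Y$ to $X$. A combinatorial chain $(R_0,\dots,R_{k-1})$ is an MBS-chain if either there is $0\le l\le k-1$ such that $R_i$ is a merge for $i<l$, $R_l$ is a bijection and $R_i$ is a splitting for $i>l$; or there is $0\le l\le k$ such that $R_i$ is a merge for $i<l$ and a splitting for $i\ge l$. It is a simple MBS-chain if moreover all its merges and splittings are simple. *)

theory Defs
  imports "HOL-Analysis.Analysis"
begin

text \<open>The metric space \<open>(M, d)\<close> is a type of class \<^class>\<open>metric_space\<close> with \<open>d\<close> being
  \<^const>\<open>dist\<close>.\<close>

definition Ran :: "'a set set" where
  "Ran = {X. finite X \<and> X \<noteq> {}}"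

text \<open>Weights live on the positive integers; the value at \<open>0\<close> is unconstrained and is never used,
  because surjective relations between configurations are non-empty.\<close>

definition weight :: "(nat \<Rightarrow> real) \<Rightarrow> bool" where
  "weight \<omega> \<longleftrightarrow> mono_on {1..} \<omega> \<and> (\<forall>n\<ge>1. 1 \<le> \<omega> n) \<and> \<omega> 1 = 1"

definition surjective_relation :: "'a set \<Rightarrow> 'a set \<Rightarrow> ('a \<times> 'a) set \<Rightarrow> bool" where
  "surjective_relation X Y R \<longleftrightarrow>
     R \<subseteq> X \<times> Y \<and> (\<forall>x\<in>X. \<exists>y\<in>Y. (x, y) \<in> R) \<and> (\<forall>y\<in>Y. \<exists>x\<in>X. (x, y) \<in> R)"

definition relation_length :: "(nat \<Rightarrow> real) \<Rightarrow> ('a::metric_space \<times> 'a) set \<Rightarrow> real" where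
  "relation_length \<omega> R = \<omega> (card R) * (\<Sum>(x, y)\<in>R. dist x y)"

text \<open>A chain with \<open>k\<close> relations is a list \<open>Xs\<close> of \<open>k + 1\<close> configurations together with a list \<open>Rs\<close>
  of \<open>k\<close> relations.\<close>

definition combinatorial_chain ::
    "'a set \<Rightarrow> 'a set \<Rightarrow> 'a set list \<Rightarrow> ('a \<times> 'a) set list \<Rightarrow> bool" where
  "combinatorial_chain X Y Xs Rs \<longleftrightarrow>
     length Xs = Suc (length Rs) \<and> set Xs \<subseteq> Ran \<and>
     Xs ! 0 = X \<and> Xs ! length Rs = Y \<and>
     (\<forall>j<length Rs. surjective_relation (Xs ! j) (Xs ! Suc j) (Rs ! j))"

definition chain_length :: "(nat \<Rightarrow> real) \<Rightarrow> ('a::metric_space \<times> 'a) set list \<Rightarrow> real" where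
  "chain_length \<omega> Rs = (\<Sum>j<length Rs. relation_length \<omega> (Rs ! j))"

definition weighted_distance ::
    "(nat \<Rightarrow> real) \<Rightarrow> 'a::metric_space set \<Rightarrow> 'a set \<Rightarrow> real" where
  "weighted_distance \<omega> X Y = Inf {chain_length \<omega> Rs | Xs Rs. combinatorial_chain X Y Xs Rs}"

definition graph_on :: "'a set \<Rightarrow> ('a \<Rightarrow> 'a) \<Rightarrow> ('a \<times> 'a) set" where
  "graph_on X f = {(x, f x) | x. x \<in> X}"

text \<open>Only the restriction of \<open>f\<close> to \<open>X\<close> matters, so preimages are intersected with \<open>X\<close>.\<close>

definition merge_via ::
    "'a set \<Rightarrow> 'a set \<Rightarrow> ('a \<times> 'a) set \<Rightarrow> ('a \<Rightarrow> 'a) \<Rightarrow> 'a \<Rightarrow> bool" where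
  "merge_via X Y R f y\<^sub>0 \<longleftrightarrow>
     surjective_relation X Y R \<and> f \<in> X \<rightarrow> Y \<and> R = graph_on X f \<and>
     y\<^sub>0 \<in> Y \<and> card (f -` {y\<^sub>0} \<inter> X) \<ge> 2 \<and> (\<forall>y\<in>Y. y \<noteq> y\<^sub>0 \<longrightarrow> f -` {y} \<inter> X = {y})"

definition is_merge :: "'a set \<Rightarrow> 'a set \<Rightarrow> ('a \<times> 'a) set \<Rightarrow> bool" where
  "is_merge X Y R \<longleftrightarrow> (\<exists>f y\<^sub>0. merge_via X Y R f y\<^sub>0)"

definition is_simple_merge :: "'a set \<Rightarrow> 'a set \<Rightarrow> ('a \<times> 'a) set \<Rightarrow> bool" where
  "is_simple_merge X Y R \<longleftrightarrow> (\<exists>f y\<^sub>0. merge_via X Y R f y\<^sub>0 \<and> card (f -` {y\<^sub>0} \<inter> X) = 2)"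

definition is_bijection :: "'a set \<Rightarrow> 'a set \<Rightarrow> ('a \<times> 'a) set \<Rightarrow> bool" where
  "is_bijection X Y R \<longleftrightarrow> (\<exists>f. bij_betw f X Y \<and> R = graph_on X f)"

definition is_splitting :: "'a set \<Rightarrow> 'a set \<Rightarrow> ('a \<times> 'a) set \<Rightarrow> bool" where
  "is_splitting X Y R \<longleftrightarrow> is_merge Y X (R\<inverse>)"

definition is_simple_splitting :: "'a set \<Rightarrow> 'a set \<Rightarrow> ('a \<times> 'a) set \<Rightarrow> bool" where
  "is_simple_splitting X Y R \<longleftrightarrow> is_simple_merge Y X (R\<inverse>)"

definition MBS_chain :: "'a set \<Rightarrow> 'a set \<Rightarrow> 'a set list \<Rightarrow> ('a \<times> 'a) set list \<Rightarrow> bool" where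
  "MBS_chain X Y Xs Rs \<longleftrightarrow>
     combinatorial_chain X Y Xs Rs \<and>
     ((\<exists>l<length Rs.
         (\<forall>i<l. is_merge (Xs ! i) (Xs ! Suc i) (Rs ! i)) \<and>
         is_bijection (Xs ! l) (Xs ! Suc l) (Rs ! l) \<and>
         (\<forall>i. l < i \<and> i < length Rs \<longrightarrow> is_splitting (Xs ! i) (Xs ! Suc i) (Rs ! i))) \<or>
      (\<exists>l\<le>length Rs.
         (\<forall>i<l. is_merge (Xs ! i) (Xs ! Suc i) (Rs ! i)) \<and>
         (\<forall>i. l \<le> i \<and> i < length Rs \<longrightarrow> is_splitting (Xs ! i) (Xs ! Suc i) (Rs ! i))))"

definition simple_MBS_chain :: "'a set \<Rightarrow> 'a set \<Rightarrow> 'a set list \<Rightarrow> ('a \<times> 'a) set list \<Rightarrow> bool" where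
  "simple_MBS_chain X Y Xs Rs \<longleftrightarrow>
     MBS_chain X Y Xs Rs \<and>
     (\<forall>i<length Rs.
        (is_merge (Xs ! i) (Xs ! Suc i) (Rs ! i) \<longrightarrow>
           is_simple_merge (Xs ! i) (Xs ! Suc i) (Rs ! i)) \<and>
        (is_splitting (Xs ! i) (Xs ! Suc i) (Rs ! i) \<longrightarrow>
           is_simple_splitting (Xs ! i) (Xs ! Suc i) (Rs ! i)))"

text \<open>Both infima are taken in \<open>real\<close>; the following facts show that they are genuine infima, i.e.
  over non-empty sets bounded below by \<open>0\<close>.\<close>

lemma chain_length_nonneg:
  assumes "weight \<omega>" "combinatorial_chain X Y Xs Rs"
  shows "0 \<le> chain_length \<omega> Rs"
  unfolding chain_length_def
proof (rule sum_nonneg)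
  fix j assume "j \<in> {..<length Rs}"
  then have j: "j < length Rs" by simp
  let ?R = "Rs ! j"
  have R: "surjective_relation (Xs ! j) (Xs ! Suc j) ?R" and X: "Xs ! j \<in> Ran" "Xs ! Suc j \<in> Ran"
    using assms(2) j by (auto simp: combinatorial_chain_def subset_eq)
  have "finite ?R"
    using R X finite_subset[of ?R "Xs ! j \<times> Xs ! Suc j"]
    by (simp add: surjective_relation_def Ran_def)
  moreover have "?R \<noteq> {}"
    using R X by (fastforce simp: surjective_relation_def Ran_def)
  ultimately have "1 \<le> card ?R" by (simp add: Suc_le_eq card_gt_0_iff)
  then have "1 \<le> \<omega> (card ?R)" using assms(1) by (simp add: weight_def)
  then show "0 \<le> relation_length \<omega> ?R"
    unfolding relation_length_def by (intro mult_nonneg_nonneg sum_nonneg) auto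
qed

lemma combinatorial_chain_Cons:
  assumes "X \<in> Ran" "surjective_relation X Z R" "combinatorial_chain Z Y Xs Rs"
  shows "combinatorial_chain X Y (X # Xs) (R # Rs)"
  using assms unfolding combinatorial_chain_def
  by (auto simp: nth_Cons split: nat.splits)

lemma combinatorial_chain_snoc:
  assumes "combinatorial_chain X Z Xs Rs" "surjective_relation Z Y R" "Y \<in> Ran"
  shows "combinatorial_chain X Y (Xs @ [Y]) (Rs @ [R])"
  using assms unfolding combinatorial_chain_def
  by (auto simp: nth_append less_Suc_eq)

lemma simple_merge_remove:
  assumes "p \<in> X" "q \<in> X" "p \<noteq> q"
  shows "is_simple_merge X (X - {q}) (graph_on X (id(q := p)))"
proof -
  let ?f = "id(q := p)"
  have fib: "?f -` {p} \<inter> X = {p, q}" using assms by (auto split: if_splits)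
  have "merge_via X (X - {q}) (graph_on X ?f) ?f p"
    unfolding merge_via_def fib
    using assms by (auto simp: surjective_relation_def graph_on_def)
  then show ?thesis
    unfolding is_simple_merge_def using fib assms by (intro exI[of _ ?f] exI[of _ p]) simp
qed

lemma is_simple_merge_imp_merge: "is_simple_merge X Y R \<Longrightarrow> is_merge X Y R"
  by (auto simp: is_simple_merge_def is_merge_def)

lemma is_merge_imp_surjective: "is_merge X Y R \<Longrightarrow> surjective_relation X Y R"
  by (auto simp: is_merge_def merge_via_def)

lemma surjective_relation_converse:
  "surjective_relation X Y (R\<inverse>) \<longleftrightarrow> surjective_relation Y X R"
  by (auto simp: surjective_relation_def)

lemma is_merge_card_less:
  assumes "is_merge X Y R" "finite X"
  shows "card Y < card X"
proof -
  obtain f y where f: "merge_via X Y R f y" using assms(1) by (auto simp: is_merge_def)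
  have "f ` X = Y"
    using f by (fastforce simp: merge_via_def surjective_relation_def graph_on_def)
  moreover have "\<not> inj_on f X"
  proof
    assume "inj_on f X"
    then have "\<exists>x. f -` {y} \<inter> X \<subseteq> {x}" by (auto simp: inj_on_def)
    then have "card (f -` {y} \<inter> X) \<le> 1"
      using card_mono[of "{_}"] by fastforce
    then show False using f by (simp add: merge_via_def)
  qed
  ultimately show ?thesis
    using assms(2) card_image_le eq_card_imp_inj_on le_neq_implies_less by metis
qed

lemma ex_simple_merges_to_point:
  assumes "finite X" "p \<in> X"
  shows "\<exists>Xs Rs. combinatorial_chain X {p} Xs Rs \<and>
    (\<forall>i<length Rs. is_simple_merge (Xs ! i) (Xs ! Suc i) (Rs ! i))"
  using assms
proof (induction X rule: finite_psubset_induct)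
  case (psubset X)
  show ?case
  proof (cases "X = {p}")
    case True
    then show ?thesis
      by (intro exI[of _ "[X]"] exI[of _ "[]"]) (simp add: combinatorial_chain_def Ran_def)
  next
    case False
    then obtain q where q: "q \<in> X" "p \<noteq> q" using psubset.prems by auto
    obtain Xs Rs where IH: "combinatorial_chain (X - {q}) {p} Xs Rs"
      "\<forall>i<length Rs. is_simple_merge (Xs ! i) (Xs ! Suc i) (Rs ! i)"
    proof -
      have "X - {q} \<subset> X" "p \<in> X - {q}" using psubset.prems q by auto
      from psubset.IH[OF this] show thesis using that by blast
    qed
    let ?R = "graph_on X (id(q := p))"
    have m: "is_simple_merge X (X - {q}) ?R"
      using simple_merge_remove psubset.prems q by metis
    have "combinatorial_chain X {p} (X # Xs) (?R # Rs)"
      using psubset q IH(1) is_merge_imp_surjective[OF is_simple_merge_imp_merge[OF m]]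
      by (intro combinatorial_chain_Cons) (auto simp: Ran_def)
    moreover have "Xs ! 0 = X - {q}" using IH(1) by (simp add: combinatorial_chain_def)
    then have "\<forall>i<length (?R # Rs). is_simple_merge ((X # Xs) ! i) ((X # Xs) ! Suc i) ((?R # Rs) ! i)"
      using IH(2) m by (auto simp: nth_Cons split: nat.splits)
    ultimately show ?thesis by blast
  qed
qed

lemma ex_merges_bijection_splittings:
  assumes "finite Y" "q \<in> Y" "X \<in> Ran"
  shows "\<exists>Xs Rs l. combinatorial_chain X Y Xs Rs \<and> l < length Rs \<and>
    (\<forall>i<l. is_simple_merge (Xs ! i) (Xs ! Suc i) (Rs ! i)) \<and>
    is_bijection (Xs ! l) (Xs ! Suc l) (Rs ! l) \<and>
    (\<forall>i. l < i \<and> i < length Rs \<longrightarrow> is_simple_splitting (Xs ! i) (Xs ! Suc i) (Rs ! i))"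
  using assms(1,2)
proof (induction Y rule: finite_psubset_induct)
  case (psubset Y)
  show ?case
  proof (cases "Y = {q}")
    case True
    obtain p where p: "p \<in> X" using assms(3) by (auto simp: Ran_def)
    obtain Xs Rs where c: "combinatorial_chain X {p} Xs Rs"
      "\<forall>i<length Rs. is_simple_merge (Xs ! i) (Xs ! Suc i) (Rs ! i)"
      using ex_simple_merges_to_point[of X p] p assms(3) by (auto simp: Ran_def)
    have len: "length Xs = Suc (length Rs)" "Xs ! length Rs = {p}"
      using c(1) by (auto simp: combinatorial_chain_def)
    have "is_bijection {p} {q} {(p, q)}"
      unfolding is_bijection_def
      by (intro exI[of _ "\<lambda>_. q"]) (auto simp: graph_on_def bij_betw_def)
    moreover have "combinatorial_chain X Y (Xs @ [Y]) (Rs @ [{(p, q)}])"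
      by (rule combinatorial_chain_snoc[OF c(1)])
         (auto simp: surjective_relation_def Ran_def True)
    ultimately show ?thesis
      using c(2) len True
      by (intro exI[of _ "Xs @ [Y]"] exI[of _ "Rs @ [{(p, q)}]"] exI[of _ "length Rs"])
         (auto simp: nth_append)
  next
    case False
    then obtain r where r: "r \<in> Y" "q \<noteq> r" using psubset.prems by auto
    obtain Xs Rs l where IH: "combinatorial_chain X (Y - {r}) Xs Rs" "l < length Rs"
      "\<forall>i<l. is_simple_merge (Xs ! i) (Xs ! Suc i) (Rs ! i)"
      "is_bijection (Xs ! l) (Xs ! Suc l) (Rs ! l)"
      "\<forall>i. l < i \<and> i < length Rs \<longrightarrow> is_simple_splitting (Xs ! i) (Xs ! Suc i) (Rs ! i)"
    proof -
      have "Y - {r} \<subset> Y" "q \<in> Y - {r}" using psubset.prems r by auto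
      from psubset.IH[OF this] show thesis using that by blast
    qed
    have len: "length Xs = Suc (length Rs)" "Xs ! length Rs = Y - {r}"
      using IH(1) by (auto simp: combinatorial_chain_def)
    define R where "R = (graph_on Y (id(r := q)))\<inverse>"
    have s: "is_simple_splitting (Y - {r}) Y R"
      using simple_merge_remove[of q Y r] psubset.prems r
      by (simp add: is_simple_splitting_def R_def)
    then have "surjective_relation (Y - {r}) Y R"
      by (meson is_merge_imp_surjective is_simple_merge_imp_merge is_simple_splitting_def
          surjective_relation_converse)
    then have "combinatorial_chain X Y (Xs @ [Y]) (Rs @ [R])"
      using combinatorial_chain_snoc[OF IH(1)] psubset by (auto simp: Ran_def)
    then show ?thesis
      using IH(2-5) len s
      by (intro exI[of _ "Xs @ [Y]"] exI[of _ "Rs @ [R]"] exI[of _ l])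
         (auto simp: nth_append less_Suc_eq)
  qed
qed

lemma ex_simple_MBS_chain:
  assumes "X \<in> Ran" "Y \<in> Ran"
  shows "\<exists>Xs Rs. simple_MBS_chain X Y Xs Rs"
proof -
  obtain q where q: "q \<in> Y" "finite Y" using assms(2) by (auto simp: Ran_def)
  obtain Xs Rs l where c: "combinatorial_chain X Y Xs Rs" "l < length Rs"
    and m: "\<forall>i<l. is_simple_merge (Xs ! i) (Xs ! Suc i) (Rs ! i)"
    and b: "is_bijection (Xs ! l) (Xs ! Suc l) (Rs ! l)"
    and s: "\<forall>i. l < i \<and> i < length Rs \<longrightarrow> is_simple_splitting (Xs ! i) (Xs ! Suc i) (Rs ! i)"
    using ex_merges_bijection_splittings[OF q(2) q(1) assms(1)] by blast
  have "MBS_chain X Y Xs Rs"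
    unfolding MBS_chain_def is_splitting_def
    using c m b s is_simple_merge_imp_merge unfolding is_simple_splitting_def by blast
  moreover have
    "(is_merge (Xs ! i) (Xs ! Suc i) (Rs ! i) \<longrightarrow> is_simple_merge (Xs ! i) (Xs ! Suc i) (Rs ! i)) \<and>
     (is_splitting (Xs ! i) (Xs ! Suc i) (Rs ! i) \<longrightarrow>
        is_simple_splitting (Xs ! i) (Xs ! Suc i) (Rs ! i))" if i: "i < length Rs" for i
  proof -
    let ?A = "Xs ! i" and ?B = "Xs ! Suc i" and ?R = "Rs ! i"
    have "finite ?A" "finite ?B"
      using c(1) i by (auto simp: combinatorial_chain_def Ran_def subset_eq)
    then have mc: "is_merge ?A ?B ?R \<Longrightarrow> card ?B < card ?A"
      and sc: "is_splitting ?A ?B ?R \<Longrightarrow> card ?A < card ?B"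
      using is_merge_card_less is_splitting_def by metis+
    consider "i < l" | "i = l" | "l < i" by linarith
    then show ?thesis
    proof cases
      case 1
      then show ?thesis using m mc sc is_simple_merge_imp_merge by (metis order.asym)
    next
      case 2
      then have "card ?A = card ?B"
        using b by (auto simp: is_bijection_def bij_betw_same_card)
      then show ?thesis using mc sc by auto
    next
      case 3
      then have "is_simple_splitting ?A ?B ?R" using s i by blast
      then show ?thesis
        using mc sc is_simple_merge_imp_merge unfolding is_simple_splitting_def is_splitting_def
        by (metis order.asym)
    qed
  qed
  ultimately show ?thesis unfolding simple_MBS_chain_def by blast
qed

lemma chain_lengths_nonempty_bdd_below:
  assumes "X \<in> Ran" "Y \<in> Ran" "weight \<omega>"
  shows "{chain_length \<omega> Rs | Xs Rs. combinatorial_chain X Y Xs Rs} \<noteq> {}"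
    and "bdd_below {chain_length \<omega> Rs | Xs Rs. combinatorial_chain X Y Xs Rs}"
    and "{chain_length \<omega> Rs | Xs Rs. simple_MBS_chain X Y Xs Rs} \<noteq> {}"
    and "bdd_below {chain_length \<omega> Rs | Xs Rs. simple_MBS_chain X Y Xs Rs}"
proof -
  have *: "simple_MBS_chain X Y Xs Rs \<Longrightarrow> combinatorial_chain X Y Xs Rs" for Xs Rs
    by (simp add: simple_MBS_chain_def MBS_chain_def)
  show "{chain_length \<omega> Rs | Xs Rs. combinatorial_chain X Y Xs Rs} \<noteq> {}"
    "{chain_length \<omega> Rs | Xs Rs. simple_MBS_chain X Y Xs Rs} \<noteq> {}"
    using ex_simple_MBS_chain[OF assms(1,2)] * by blast+
  show "bdd_below {chain_length \<omega> Rs | Xs Rs. combinatorial_chain X Y Xs Rs}"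
    "bdd_below {chain_length \<omega> Rs | Xs Rs. simple_MBS_chain X Y Xs Rs}"
    by (rule bdd_belowI[of _ 0]; use chain_length_nonneg[OF assms(3)] * in blast)+
qed

end

theory Submission imports Defs begin

text \<open>
  Simple MBS-chains are combinatorial chains, so only one inequality needs an argument: every
  chain from \<open>X\<close> to \<open>Y\<close> is at least as long as some simple MBS-chain. View the chain as a
  layered graph whose \<open>j\<close>-th layer is the configuration \<open>X\<^sub>j\<close> and whose edges are the related
  pairs, and look at the first step at which two edges \<open>(a, v)\<close>, \<open>(b, v)\<close> meet. Up to that step
  every vertex has only one incoming edge, so each of \<open>a\<close>, \<open>b\<close> is the end of only one path from
  the initial configuration.

  If such a path branches, the part of the path from its last branching vertex to \<open>v\<close> is
  superfluous: deleting it leaves a chain with the same ends, and since \<open>\<omega>\<close> is non-decreasing the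
  chain does not get longer (\<open>detour_deletion\<close>). If the paths do not branch, their edges can
  be performed at once by a simple merge into \<open>v\<close> at the very beginning, after which the merged
  point waits at \<open>v\<close> (\<open>path_contraction\<close>). This is where the weight matters: as no earlier step
  identifies points, every one of these steps has at least \<open>card X\<close> edges, and the
  merge, which has exactly \<open>card X\<close> edges, is paid for by the deleted edges and the triangle
  inequality. If \<open>v\<close> is not in \<open>X\<close>, both paths are contracted; if \<open>v\<close> is in \<open>X\<close>, contracting one
  of them already is a simple merge, and this choice avoids collisions with points in place.

  Each of the two operations decreases the pair of \<open>card X + card Y\<close> and the number of edges in
  the lexicographic order. Branching without any meeting edges is the same situation in the reversed
  chain, and a chain with neither is a sequence of bijections, which compose to one
  bijection that is no longer. Induction therefore produces merges at the front, splittings at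
  the end and one bijection in between.
\<close>

section \<open>Lengths of relations\<close>

lemma weight_mono: "weight \<omega> \<Longrightarrow> 1 \<le> m \<Longrightarrow> m \<le> n \<Longrightarrow> \<omega> m \<le> \<omega> n"
  by (auto simp: weight_def mono_on_def)

lemma weight_ge_1: "weight \<omega> \<Longrightarrow> 1 \<le> n \<Longrightarrow> 1 \<le> \<omega> n"
  by (auto simp: weight_def)

lemma relation_length_mono:
  assumes "weight \<omega>" "finite R" "S \<subseteq> R" "S \<noteq> {}"
  shows "relation_length \<omega> S \<le> relation_length \<omega> R"
proof -
  have "finite S" using assms finite_subset by blast
  then have 1: "1 \<le> card S" using assms by (simp add: Suc_le_eq card_gt_0_iff)
  have 2: "card S \<le> card R" using assms card_mono by blast
  have "(\<Sum>(x, y)\<in>S. dist x y) \<le> (\<Sum>(x, y)\<in>R. dist x y)"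
    by (rule sum_mono2) (use assms in auto)
  then show ?thesis
    unfolding relation_length_def
    using weight_mono[OF assms(1) 1 2] weight_ge_1[OF assms(1), of "card R"] 1 2
    by (intro mult_mono) (auto intro!: sum_nonneg)
qed

text \<open>A stationary edge may replace a set \<open>D\<close> of edges, and the saving is at least what \<open>D\<close> costs
  at any smaller weight. This is how the deleted edges pay for a merge.\<close>

lemma relation_length_stop_edges:
  fixes v :: "'a::metric_space"
  assumes "weight \<omega>" "finite R" "D \<subseteq> R" "D \<noteq> {}" "1 \<le> n" "n \<le> card R"
  shows "relation_length \<omega> (insert (v, v) (R - D)) + \<omega> n * (\<Sum>(x, y)\<in>D. dist x y)
    \<le> relation_length \<omega> R"
proof -
  define f :: "'a \<times> 'a \<Rightarrow> real" where "f = (\<lambda>(x, y). dist x y)"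
  let ?R' = "insert (v, v) (R - D)"
  have D: "finite D" using assms finite_subset by blast
  have "card (R - D) < card R"
    using assms by (intro psubset_card_mono) auto
  then have c2: "card ?R' \<le> card R"
    using card_insert_le_m1[of "card R" "R - D" "(v, v)"] by simp
  have c1: "1 \<le> card ?R'" using assms by (simp add: Suc_le_eq card_gt_0_iff)
  have f0: "0 \<le> f e" for e by (cases e) (simp add: f_def)
  have "sum f ?R' = sum f (R - D)"
    using assms by (cases "(v, v) \<in> R - D") (simp_all add: insert_absorb f_def del: Diff_iff)
  moreover have "sum f R = sum f (R - D) + sum f D"
    using assms by (simp add: sum.subset_diff)
  moreover have "\<omega> (card ?R') * sum f (R - D) \<le> \<omega> (card R) * sum f (R - D)"
    using weight_mono[OF assms(1) c1 c2] by (intro mult_right_mono sum_nonneg f0)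
  moreover have "\<omega> n * sum f D \<le> \<omega> (card R) * sum f D"
    using weight_mono[OF assms(1,5,6)] by (intro mult_right_mono sum_nonneg f0)
  ultimately show ?thesis
    unfolding relation_length_def f_def[symmetric] by (simp add: algebra_simps)
qed

lemma relation_length_converse: "relation_length \<omega> (R\<inverse>) = relation_length \<omega> R"
proof -
  have "R\<inverse> = prod.swap ` R" by auto
  moreover have "(\<Sum>(x, y)\<in>prod.swap ` R. dist x y) = (\<Sum>(x, y)\<in>R. dist x y)"
    by (subst sum.reindex) (auto simp: dist_commute intro!: sum.cong)
  ultimately show ?thesis
    unfolding relation_length_def by (simp add: card_image)
qed

lemma relation_length_graph_on:
  "relation_length \<omega> (graph_on X f) = \<omega> (card X) * (\<Sum>x\<in>X. dist x (f x))"
proof -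
  have g: "graph_on X f = (\<lambda>x. (x, f x)) ` X" by (auto simp: graph_on_def)
  have i: "inj_on (\<lambda>x. (x, f x)) X" by (auto simp: inj_on_def)
  show ?thesis
    unfolding relation_length_def g card_image[OF i] sum.reindex[OF i] by simp
qed

lemma surjective_relation_finite:
  assumes "surjective_relation X Y R" "X \<in> Ran" "Y \<in> Ran"
  shows "finite R" "R \<noteq> {}"
proof -
  show "finite R" using assms finite_subset[of R "X \<times> Y"]
    by (simp add: surjective_relation_def Ran_def)
  show "R \<noteq> {}" using assms by (fastforce simp: surjective_relation_def Ran_def)
qed

lemma surjective_relation_card_left:
  assumes "surjective_relation X Y R" "finite R"
  shows "card X \<le> card R"
proof -
  have "X \<subseteq> fst ` R" using assms(1) by (force simp: surjective_relation_def)
  then show ?thesis using surj_card_le[OF assms(2)] by blast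
qed

lemma surjective_relation_card_right:
  assumes "surjective_relation X Y R" "\<And>x x' y. (x, y) \<in> R \<Longrightarrow> (x', y) \<in> R \<Longrightarrow> x = x'"
  shows "card R = card Y"
proof -
  have "snd ` R = Y" using assms(1) by (force simp: surjective_relation_def)
  moreover have "inj_on snd R" using assms(2) by (auto simp: inj_on_def)
  ultimately show ?thesis using card_image by metis
qed

section \<open>Chains as layered graphs\<close>

text \<open>Chains indexed by functions instead of lists: the operations below change all layers of an
  initial segment at once, which is a case distinction on the index.\<close>

definition layered_chain :: "nat \<Rightarrow> (nat \<Rightarrow> 'a set) \<Rightarrow> (nat \<Rightarrow> ('a \<times> 'a) set) \<Rightarrow> bool" where
  "layered_chain k X R \<longleftrightarrow> (\<forall>j\<le>k. X j \<in> Ran) \<and> (\<forall>j<k. surjective_relation (X j) (X (Suc j)) (R j))"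

definition layered_length ::
    "(nat \<Rightarrow> real) \<Rightarrow> nat \<Rightarrow> (nat \<Rightarrow> ('a::metric_space \<times> 'a) set) \<Rightarrow> real" where
  "layered_length \<omega> k R = (\<Sum>j<k. relation_length \<omega> (R j))"

definition edge_count :: "nat \<Rightarrow> (nat \<Rightarrow> ('a \<times> 'a) set) \<Rightarrow> nat" where
  "edge_count k R = (\<Sum>j<k. card (R j))"

lemma layered_chainD:
  assumes "layered_chain k X R" "j < k"
  shows "surjective_relation (X j) (X (Suc j)) (R j)" "finite (R j)" "R j \<noteq> {}"
    "X j \<in> Ran" "X (Suc j) \<in> Ran"
proof -
  show s: "surjective_relation (X j) (X (Suc j)) (R j)" and x: "X j \<in> Ran" "X (Suc j) \<in> Ran"
    using assms by (auto simp: layered_chain_def)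
  show "finite (R j)" "R j \<noteq> {}" using surjective_relation_finite[OF s x] by auto
qed

lemma layered_chainI:
  assumes "X 0 \<noteq> {}" "\<And>j. j \<le> k \<Longrightarrow> finite (X j)"
    and "\<And>j. j < k \<Longrightarrow> surjective_relation (X j) (X (Suc j)) (R j)"
  shows "layered_chain k X R"
proof -
  have "X j \<noteq> {}" if "j \<le> k" for j
    using that
  proof (induction j)
    case (Suc j)
    then show ?case using assms(3)[of j] by (force simp: surjective_relation_def)
  qed (use assms in simp)
  then show ?thesis using assms by (auto simp: layered_chain_def Ran_def)
qed

lemma layered_chain_reverse:
  assumes "layered_chain k X R"
  defines "R' \<equiv> \<lambda>j. (R (k - Suc j))\<inverse>"
  shows "layered_chain k (\<lambda>j. X (k - j)) R'" "layered_length \<omega> k R' = layered_length \<omega> k R"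
    "edge_count k R' = edge_count k R"
proof -
  have "surjective_relation (X (k - j)) (X (k - Suc j)) (R' j)" if "j < k" for j
  proof -
    have "surjective_relation (X (k - Suc j)) (X (Suc (k - Suc j))) (R (k - Suc j))"
      using layered_chainD(1)[OF assms(1)] that by simp
    then show ?thesis using that
      by (simp add: R'_def surjective_relation_converse Suc_diff_Suc)
  qed
  then show "layered_chain k (\<lambda>j. X (k - j)) R'"
    using assms(1) by (auto simp: layered_chain_def)
  show "layered_length \<omega> k R' = layered_length \<omega> k R"
    unfolding layered_length_def R'_def relation_length_converse
    by (rule sum.nat_diff_reindex)
  show "edge_count k R' = edge_count k R"
    unfolding edge_count_def R'_def card_inverse
    by (rule sum.nat_diff_reindex)
qed

lemma layered_chain_backward_path:
  assumes "layered_chain k X R" "t \<le> k" "a \<in> X t"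
  obtains p where "p t = a" "\<And>s. s < t \<Longrightarrow> (p s, p (Suc s)) \<in> R s"
proof -
  have "\<exists>p. p t = a \<and> (\<forall>s<t. (p s, p (Suc s)) \<in> R s)"
    using assms(2,3)
  proof (induction t arbitrary: a)
    case (Suc t)
    then obtain b where b: "b \<in> X t" "(b, a) \<in> R t"
      using layered_chainD(1)[OF assms(1), of t] by (force simp: surjective_relation_def)
    then obtain p where "p t = b" "\<forall>s<t. (p s, p (Suc s)) \<in> R s"
      using Suc.IH[of b] Suc.prems by auto
    then show ?case
      using b Suc.prems by (intro exI[of _ "p(Suc t := a)"]) (auto simp: less_Suc_eq)
  qed (auto intro: exI[of _ "\<lambda>_. a"])
  then show ?thesis using that by blast
qed

section \<open>Removing a merge\<close>

text \<open>The part of a path from its last branching vertex to the first vertex at which it meets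
  another edge is a detour: its start keeps another outgoing edge, its end keeps another incoming
  one, and nothing else is attached to it.\<close>

lemma detour_deletion:
  assumes chain: "layered_chain k X R" and w: "weight \<omega>" and t: "t < k"
    and inj: "\<And>s x x' y. s < t \<Longrightarrow> (x, y) \<in> R s \<Longrightarrow> (x', y) \<in> R s \<Longrightarrow> x = x'"
    and p: "\<And>s. s \<le> t \<Longrightarrow> (p s, p (Suc s)) \<in> R s"
    and meet: "(b, p (Suc t)) \<in> R t" "b \<noteq> p t"
    and branch: "i \<le> t" "(p i, z) \<in> R i" "z \<noteq> p (Suc i)"
    and last: "\<And>s y. i < s \<Longrightarrow> s \<le> t \<Longrightarrow> (p s, y) \<in> R s \<Longrightarrow> y = p (Suc s)"
  shows "\<exists>X' R'. layered_chain k X' R' \<and> X' 0 = X 0 \<and> X' k = X k \<and>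
    layered_length \<omega> k R' \<le> layered_length \<omega> k R \<and> edge_count k R' < edge_count k R"
proof -
  define X' where "X' s = (if i < s \<and> s \<le> t then X s - {p s} else X s)" for s
  define R' where "R' s = (if i \<le> s \<and> s \<le> t then R s - {(p s, p (Suc s))} else R s)" for s
  have surj: "surjective_relation (X' s) (X' (Suc s)) (R' s)" if s: "s < k" for s
  proof (cases "i \<le> s \<and> s \<le> t")
    case False
    then show ?thesis using layered_chainD(1)[OF chain s] by (auto simp: X'_def R'_def)
  next
    case True
    have R: "R s \<subseteq> X s \<times> X (Suc s)" "\<forall>x\<in>X s. \<exists>y. (x, y) \<in> R s" "\<forall>y\<in>X (Suc s). \<exists>x. (x, y) \<in> R s"
      using layered_chainD(1)[OF chain s] by (auto simp: surjective_relation_def)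
    have sub: "R' s \<subseteq> X' s \<times> X' (Suc s)"
    proof
      fix e assume e: "e \<in> R' s"
      obtain x y where xy: "e = (x, y)" by (cases e)
      have "(x, y) \<in> R s" "(x, y) \<noteq> (p s, p (Suc s))" using e xy True by (auto simp: R'_def)
      moreover from this have "i < s \<Longrightarrow> x \<noteq> p s" using last[of s y] True by blast
      moreover have "Suc s \<le> t \<Longrightarrow> y \<noteq> p (Suc s)"
        using inj[of s x "p (Suc s)" "p s"] p[of s] calculation True by auto
      ultimately show "e \<in> X' s \<times> X' (Suc s)" using R(1) xy by (auto simp: X'_def)
    qed
    have "\<exists>y. (x, y) \<in> R' s" if x: "x \<in> X' s" for x
    proof (cases "x = p s")
      case True': True
      then have "s = i" using x True by (auto simp: X'_def split: if_splits)
      then show ?thesis using branch True' True by (auto simp: R'_def)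
    next
      case False
      then show ?thesis using R(2) x True by (auto simp: X'_def R'_def split: if_splits)
    qed
    moreover have "\<exists>x. (x, y) \<in> R' s" if y: "y \<in> X' (Suc s)" for y
    proof (cases "y = p (Suc s)")
      case True': True
      then have "s = t" using y True by (auto simp: X'_def split: if_splits)
      then show ?thesis using meet True' True by (auto simp: R'_def)
    next
      case False
      then show ?thesis using R(3) y True by (auto simp: X'_def R'_def split: if_splits)
    qed
    ultimately show ?thesis using sub unfolding surjective_relation_def by blast
  qed
  have "X 0 \<in> Ran" "\<And>j. j \<le> k \<Longrightarrow> X j \<in> Ran" using chain by (auto simp: layered_chain_def)
  then have chain': "layered_chain k X' R'"
    by (intro layered_chainI surj) (auto simp: X'_def Ran_def)
  have sub: "R' j \<subseteq> R j" for j by (auto simp: R'_def)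
  have "layered_length \<omega> k R' \<le> layered_length \<omega> k R"
    unfolding layered_length_def
    using layered_chainD(2)[OF chain] layered_chainD(3)[OF chain'] sub w
    by (intro sum_mono relation_length_mono) auto
  moreover have "edge_count k R' < edge_count k R"
    unfolding edge_count_def
  proof (rule sum_strict_mono_ex1)
    show "\<forall>j\<in>{..<k}. card (R' j) \<le> card (R j)"
      using layered_chainD(2)[OF chain] sub by (auto intro!: card_mono)
    have "R' t \<subset> R t" using branch(1) p[of t] by (auto simp: R'_def)
    then show "\<exists>j\<in>{..<k}. card (R' j) < card (R j)"
      using t layered_chainD(2)[OF chain t] psubset_card_mono by blast
  qed simp
  ultimately show ?thesis using chain' t by (intro exI[of _ X'] exI[of _ R']) (auto simp: X'_def)
qed

text \<open>As long as no two edges meet, the number of points cannot decrease, so that every step up to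
  the first meeting is weighted at least like the initial configuration.\<close>

lemma card_start_le_card_step:
  assumes chain: "layered_chain k X R" and t: "t < k"
    and inj: "\<And>s x x' y. s < t \<Longrightarrow> (x, y) \<in> R s \<Longrightarrow> (x', y) \<in> R s \<Longrightarrow> x = x'"
    and s: "s \<le> t"
  shows "card (X 0) \<le> card (R s)"
proof -
  have le: "card (X s) \<le> card (R s)" if "s < k" for s
    using surjective_relation_card_left layered_chainD[OF chain that] by blast
  have "card (X 0) \<le> card (X s)" if "s \<le> t" for s
    using that
  proof (induction s)
    case (Suc s)
    then have "card (R s) = card (X (Suc s))"
      using t layered_chainD(1)[OF chain, of s] inj[of s]
      by (intro surjective_relation_card_right) auto
    then show ?case using Suc le[of s] t by simp
  qed simp
  then show ?thesis using s le[of s] t by fastforce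
qed

text \<open>Paths without branching that start in \<open>I\<close> and meet at \<open>v\<close> are contracted to a point waiting
  at \<open>v\<close>. The weight \<open>\<omega> (card (X 0))\<close> is the one of a relation that moves \<open>I\<close> to \<open>v\<close> and fixes all
  other points of \<open>X 0\<close>. The point \<open>v\<close> may already be occupied in some layers.\<close>

lemma path_contraction:
  assumes chain: "layered_chain k X R" and w: "weight \<omega>" and t: "t < k"
    and inj: "\<And>s x x' y. s < t \<Longrightarrow> (x, y) \<in> R s \<Longrightarrow> (x', y) \<in> R s \<Longrightarrow> x = x'"
    and I: "finite I" "I \<noteq> {}"
    and start: "\<And>x. x \<in> I \<Longrightarrow> p x 0 = x" and stop: "\<And>x. x \<in> I \<Longrightarrow> p x (Suc t) = v"
    and p: "\<And>x s. x \<in> I \<Longrightarrow> s \<le> t \<Longrightarrow> (p x s, p x (Suc s)) \<in> R s"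
    and unbranched: "\<And>x s y. x \<in> I \<Longrightarrow> s \<le> t \<Longrightarrow> (p x s, y) \<in> R s \<Longrightarrow> y = p x (Suc s)"
  shows "\<exists>X' R'. layered_chain k X' R' \<and> X' 0 = insert v (X 0 - I) \<and> X' k = X k \<and>
    layered_length \<omega> k R' + \<omega> (card (X 0)) * (\<Sum>x\<in>I. dist x v) \<le> layered_length \<omega> k R"
proof -
  define P where "P s = (\<lambda>x. p x s) ` I" for s
  define D where "D s = (\<lambda>x. (p x s, p x (Suc s))) ` I" for s
  define X' where "X' s = (if s \<le> t then insert v (X s - P s) else X s)" for s
  define R' where "R' s = (if s \<le> t then insert (v, v) (R s - D s) else R s)" for s
  have DR: "D s \<subseteq> R s" if "s \<le> t" for s using p that by (auto simp: D_def)
  have v: "v \<in> X (Suc t)"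
  proof -
    obtain x where "x \<in> I" using I by blast
    then have "(p x t, v) \<in> R t" using p[of x t] stop by simp
    then show ?thesis using layered_chainD(1)[OF chain t] by (auto simp: surjective_relation_def)
  qed
  have surj: "surjective_relation (X' s) (X' (Suc s)) (R' s)" if s: "s < k" for s
  proof (cases "s \<le> t")
    case False
    then show ?thesis using layered_chainD(1)[OF chain s] by (auto simp: X'_def R'_def)
  next
    case st: True
    have R: "R s \<subseteq> X s \<times> X (Suc s)" "\<forall>x\<in>X s. \<exists>y. (x, y) \<in> R s" "\<forall>y\<in>X (Suc s). \<exists>x. (x, y) \<in> R s"
      using layered_chainD(1)[OF chain s] by (auto simp: surjective_relation_def)
    have fst_D: "(x, y) \<in> D s \<longleftrightarrow> x \<in> P s" if "(x, y) \<in> R s" for x y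
      using unbranched[OF _ st] that by (auto simp: D_def P_def)
    have snd_D: "(x, y) \<in> D s \<longleftrightarrow> y \<in> P (Suc s)" if "(x, y) \<in> R s" "s < t" for x y
    proof
      assume "y \<in> P (Suc s)"
      then obtain z where z: "z \<in> I" "y = p z (Suc s)" by (auto simp: P_def)
      then have "x = p z s" using inj[OF that(2,1)] p[OF z(1) st] by blast
      then show "(x, y) \<in> D s" using z by (auto simp: D_def)
    qed (auto simp: D_def P_def)
    have X's: "X' s = insert v (X s - P s)" and R's: "R' s = insert (v, v) (R s - D s)"
      using st by (auto simp: X'_def R'_def)
    \<comment> \<open>The next layer is treated in the same way for \<open>s < t\<close> and for \<open>s = t\<close>, although only in the
      first case points are removed from it.\<close>
    have target: "v \<in> X' (Suc s)" "\<And>x y. (x, y) \<in> R s - D s \<Longrightarrow> y \<in> X' (Suc s)"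
      "\<And>y. y \<in> X' (Suc s) \<Longrightarrow> y \<noteq> v \<Longrightarrow> y \<in> X (Suc s) \<and> (\<forall>x. (x, y) \<notin> D s)"
    proof -
      have "s = t \<Longrightarrow> X' (Suc s) = X (Suc s)" "s = t \<Longrightarrow> (x, y) \<in> D s \<Longrightarrow> y = v" for x y
        using stop by (auto simp: X'_def D_def)
      moreover have "s \<noteq> t \<Longrightarrow> s < t \<and> X' (Suc s) = insert v (X (Suc s) - P (Suc s))"
        using st by (auto simp: X'_def)
      moreover have "(x, y) \<in> D s \<Longrightarrow> y \<in> P (Suc s)" for x y by (auto simp: D_def P_def)
      ultimately show "v \<in> X' (Suc s)" "\<And>x y. (x, y) \<in> R s - D s \<Longrightarrow> y \<in> X' (Suc s)"
        "\<And>y. y \<in> X' (Suc s) \<Longrightarrow> y \<noteq> v \<Longrightarrow> y \<in> X (Suc s) \<and> (\<forall>x. (x, y) \<notin> D s)"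
        using v R(1) snd_D by (cases "s = t"; auto)+
    qed
    have "R' s \<subseteq> X' s \<times> X' (Suc s)"
    proof
      fix e assume "e \<in> R' s"
      then show "e \<in> X' s \<times> X' (Suc s)"
        using R(1) fst_D target(1,2) unfolding X's R's by (cases e) blast
    qed
    moreover have "\<exists>y. (x, y) \<in> R' s" if "x \<in> X' s" for x
      using that R(2) fst_D unfolding X's R's by blast
    moreover have "\<exists>x. (x, y) \<in> R' s" if "y \<in> X' (Suc s)" for y
      using target(3)[OF that] R(3) unfolding R's by blast
    ultimately show ?thesis unfolding surjective_relation_def by blast
  qed
  have fin: "finite (X j)" if "j \<le> k" for j
    using chain that by (auto simp: layered_chain_def Ran_def)
  have chain': "layered_chain k X' R'"
    by (intro layered_chainI surj) (auto simp: X'_def fin)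
  \<comment> \<open>The paths stay disjoint before they meet at \<open>v\<close>, so no deleted edge is counted twice.\<close>
  have P_inj: "x = y" if "x \<in> I" "y \<in> I" "s \<le> t" "p x s = p y s" for x y s
    using that(3,4)
  proof (induction s)
    case (Suc s)
    then show ?case using inj[of s "p x s" "p x (Suc s)" "p y s"] p[of x s] p[of y s] that(1,2) by simp
  qed (use start that(1,2) in simp)
  let ?n = "card (X 0)"
  let ?\<delta> = "\<lambda>s. \<Sum>x\<in>I. dist (p x s) (p x (Suc s))"
  have n: "1 \<le> ?n"
    using chain by (auto simp: layered_chain_def Ran_def Suc_le_eq card_gt_0_iff)
  have step: "relation_length \<omega> (R' s) + (if s \<le> t then \<omega> ?n * ?\<delta> s else 0) \<le> relation_length \<omega> (R s)"
    if "s < k" for s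
  proof (cases "s \<le> t")
    case True
    have "inj_on (\<lambda>x. (p x s, p x (Suc s))) I" using P_inj True by (auto simp: inj_on_def)
    then have "(\<Sum>(x, y)\<in>D s. dist x y) = ?\<delta> s" unfolding D_def by (subst sum.reindex) auto
    moreover have "D s \<noteq> {}" using I by (simp add: D_def)
    moreover have "?n \<le> card (R s)" by (rule card_start_le_card_step[OF chain t _ True]) (rule inj)
    ultimately show ?thesis
      using relation_length_stop_edges[OF w layered_chainD(2)[OF chain that] DR[OF True] _ n, of v] True
      by (simp add: R'_def)
  qed (simp add: R'_def)
  have "layered_length \<omega> k R' + (\<Sum>s<k. if s \<le> t then \<omega> ?n * ?\<delta> s else 0) \<le> layered_length \<omega> k R"
    unfolding layered_length_def sum.distrib[symmetric] using step by (intro sum_mono) auto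
  moreover have "(\<Sum>s<k. if s \<le> t then \<omega> ?n * ?\<delta> s else 0) = (\<Sum>s\<le>t. \<omega> ?n * ?\<delta> s)"
  proof -
    have "{..<k} \<inter> {s. s \<le> t} = {..t}" using t by auto
    then show ?thesis by (simp add: sum.If_cases)
  qed
  moreover have "\<dots> = \<omega> ?n * (\<Sum>x\<in>I. \<Sum>s\<le>t. dist (p x s) (p x (Suc s)))"
    by (simp add: sum_distrib_left[symmetric] sum.swap[of _ I])
  moreover have "dist (p x 0) (p x (Suc m)) \<le> (\<Sum>s\<le>m. dist (p x s) (p x (Suc s)))" for x m
  proof (induction m)
    case (Suc m)
    then show ?case
      using dist_triangle[of "p x 0" "p x (Suc (Suc m))" "p x (Suc m)"] by simp
  qed simp
  then have "(\<Sum>x\<in>I. dist x v) \<le> (\<Sum>x\<in>I. \<Sum>s\<le>t. dist (p x s) (p x (Suc s)))"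
    using start stop by (intro sum_mono) metis
  then have "\<omega> ?n * (\<Sum>x\<in>I. dist x v) \<le> \<omega> ?n * (\<Sum>x\<in>I. \<Sum>s\<le>t. dist (p x s) (p x (Suc s)))"
    using weight_ge_1[OF w n] by (intro mult_left_mono) auto
  moreover have "X' 0 = insert v (X 0 - I)"
    using start by (auto simp: X'_def P_def image_iff)
  moreover have "X' k = X k" using t by (simp add: X'_def)
  ultimately show ?thesis using chain' by (intro exI[of _ X'] exI[of _ R']) auto
qed

text \<open>The cardinality condition covers both ways in which a simple merge arises: two points move to
  an unoccupied \<open>v\<close>, or one point moves to another point \<open>v\<close> of the configuration.\<close>

lemma simple_merge_collapse:
  assumes "X \<in> Ran" "I \<subseteq> X" "v \<notin> I" "card (I \<union> ({v} \<inter> X)) = 2"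
  shows "is_simple_merge X (insert v (X - I)) (graph_on X (\<lambda>x. if x \<in> I then v else x))"
proof -
  let ?f = "\<lambda>x. if x \<in> I then v else x"
  have fib: "?f -` {v} \<inter> X = I \<union> ({v} \<inter> X)" using assms(2,3) by auto
  have "I \<noteq> {}" using assms(4) card_mono[of "{v}" "{v} \<inter> X"] by auto
  then have "merge_via X (insert v (X - I)) (graph_on X ?f) ?f v"
    using assms(2-4) unfolding merge_via_def fib
    by (auto simp: surjective_relation_def graph_on_def)
  then show ?thesis
    unfolding is_simple_merge_def using fib assms(4) by (intro exI[of _ ?f] exI[of _ v]) simp
qed

text \<open>At the first step at which edges meet, paths back from the two meeting edges either branch, so
  that one of them contains a detour, or do not branch. In the latter case they have distinct
  starting points, since paths without branching are determined by their starts, and contracting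
  them, or only one of them, amounts to a simple merge.\<close>

lemma delete_detour_or_extract_merge:
  assumes chain: "layered_chain k X R" and w: "weight \<omega>"
    and meet: "j < k" "(a, v) \<in> R j" "(b, v) \<in> R j" "a \<noteq> b"
  shows "(\<exists>X' R'. layered_chain k X' R' \<and> X' 0 = X 0 \<and> X' k = X k \<and>
      layered_length \<omega> k R' \<le> layered_length \<omega> k R \<and> edge_count k R' < edge_count k R) \<or>
    (\<exists>X' R' S. layered_chain k X' R' \<and> is_simple_merge (X 0) (X' 0) S \<and> X' k = X k \<and>
      relation_length \<omega> S + layered_length \<omega> k R' \<le> layered_length \<omega> k R)"
    (is "?shorter \<or> ?merge")
proof -
  define meets where "meets j \<longleftrightarrow> (\<exists>a b v. (a, v) \<in> R j \<and> (b, v) \<in> R j \<and> a \<noteq> b)" for j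
  define t where "t = (LEAST j. meets j)"
  have "meets j" using meet by (auto simp: meets_def)
  then have mt: "meets t" and "t \<le> j" unfolding t_def by (rule LeastI, rule Least_le)
  then have t: "t < k" using meet(1) by simp
  have inj: "x = x'" if "s < t" "(x, y) \<in> R s" "(x', y) \<in> R s" for s x x' y
    using not_less_Least[of s meets] that unfolding t_def meets_def by blast
  obtain a b v where ab: "(a, v) \<in> R t" "(b, v) \<in> R t" "a \<noteq> b" using mt by (auto simp: meets_def)
  have path: "\<exists>p. p t = c \<and> p (Suc t) = v \<and> (\<forall>s\<le>t. (p s, p (Suc s)) \<in> R s)"
    if "(c, v) \<in> R t" for c
  proof -
    have "c \<in> X t" using layered_chainD(1)[OF chain t] that by (auto simp: surjective_relation_def)
    then obtain p where "p t = c" "\<And>s. s < t \<Longrightarrow> (p s, p (Suc s)) \<in> R s"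
      using layered_chain_backward_path[OF chain, of t c] t by auto
    then show ?thesis
      using that by (intro exI[of _ "p(Suc t := v)"]) (auto simp: le_less)
  qed
  obtain p where p: "p t = a" "p (Suc t) = v" "\<And>s. s \<le> t \<Longrightarrow> (p s, p (Suc s)) \<in> R s"
    using path[OF ab(1)] by auto
  obtain q where q: "q t = b" "q (Suc t) = v" "\<And>s. s \<le> t \<Longrightarrow> (q s, q (Suc s)) \<in> R s"
    using path[OF ab(2)] by auto
  have unbranched: "y = r (Suc s)"
    if "\<not> ?shorter" "s \<le> t" "(r s, y) \<in> R s"
      and r: "\<And>s. s \<le> t \<Longrightarrow> (r s, r (Suc s)) \<in> R s" "(c, r (Suc t)) \<in> R t" "c \<noteq> r t" for r c s y
  proof (rule ccontr)
    assume ne: "y \<noteq> r (Suc s)"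
    \<comment> \<open>The last branching vertex, where the detour starts.\<close>
    define i where "i = (GREATEST i. i \<le> t \<and> (\<exists>y. (r i, y) \<in> R i \<and> y \<noteq> r (Suc i)))"
    have ex: "s \<le> t \<and> (\<exists>y. (r s, y) \<in> R s \<and> y \<noteq> r (Suc s))" using that(2,3) ne by blast
    have "i \<le> t \<and> (\<exists>y. (r i, y) \<in> R i \<and> y \<noteq> r (Suc i))"
      unfolding i_def by (rule GreatestI_nat[of _ s t]) (use ex in auto)
    then obtain z where z: "i \<le> t" "(r i, z) \<in> R i" "z \<noteq> r (Suc i)" by blast
    have last: "y = r (Suc s)" if "i < s" "s \<le> t" "(r s, y) \<in> R s" for s y
    proof (rule ccontr)
      assume "y \<noteq> r (Suc s)"
      then have "s \<le> i" unfolding i_def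
        by (intro Greatest_le_nat[where b = t]) (use that in auto)
      then show False using that by simp
    qed
    have ?shorter
      by (rule detour_deletion[OF chain w t, where p = r and b = c and i = i and z = z])
         (use inj r z last in blast)+
    then show False using that(1) by blast
  qed
  show ?thesis
  proof (cases ?shorter)
    case False
    have unp: "y = p (Suc s)" if "s \<le> t" "(p s, y) \<in> R s" for s y
      using unbranched[OF False that p(3), of b] ab p by auto
    have unq: "y = q (Suc s)" if "s \<le> t" "(q s, y) \<in> R s" for s y
      using unbranched[OF False that q(3), of a] ab q by auto
    have "p s = q s" if "p 0 = q 0" "s \<le> t" for s
      using that(2)
    proof (induction s)
      case (Suc s)
      then show ?case using unp[of s "q (Suc s)"] q(3)[of s] by simp
    qed (use that in simp)
    then have pq: "p 0 \<noteq> q 0" using p(1) q(1) ab(3) by blast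
    have X0: "p 0 \<in> X 0" "q 0 \<in> X 0"
      using layered_chainD(1)[OF chain, of 0] t p(3)[of 0] q(3)[of 0]
      by (auto simp: surjective_relation_def)
    \<comment> \<open>If \<open>v\<close> is occupied initially, a path that does not start at \<open>v\<close> is contracted alone: the merge
      identifies its start with the point at \<open>v\<close>, which keeps its own onward edges.\<close>
    define I where "I = (if v \<in> X 0 then if p 0 = v then {q 0} else {p 0} else {p 0, q 0})"
    define path_from where "path_from x = (if x = p 0 then p else q)" for x
    have I: "finite I" "I \<noteq> {}" "I \<subseteq> X 0" "v \<notin> I" "card (I \<union> ({v} \<inter> X 0)) = 2"
      "I \<subseteq> {p 0, q 0}"
      using X0 pq by (auto simp: I_def Int_insert_left)
    let ?S = "graph_on (X 0) (\<lambda>x. if x \<in> I then v else x)"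
    have contraction: "\<exists>X' R'. layered_chain k X' R' \<and> X' 0 = insert v (X 0 - I) \<and> X' k = X k \<and>
        layered_length \<omega> k R' + \<omega> (card (X 0)) * (\<Sum>x\<in>I. dist x v) \<le> layered_length \<omega> k R"
    proof (rule path_contraction[OF chain w t _ I(1,2), where p = path_from])
      show "\<And>s x x' y. s < t \<Longrightarrow> (x, y) \<in> R s \<Longrightarrow> (x', y) \<in> R s \<Longrightarrow> x = x'" by (rule inj)
    next
      fix x assume x: "x \<in> I"
      then have "x = p 0 \<or> x = q 0" using I(6) by auto
      then show "path_from x 0 = x" "path_from x (Suc t) = v"
        "\<And>s. s \<le> t \<Longrightarrow> (path_from x s, path_from x (Suc s)) \<in> R s"
        "\<And>s y. s \<le> t \<Longrightarrow> (path_from x s, y) \<in> R s \<Longrightarrow> y = path_from x (Suc s)"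
        using p q unp unq by (auto simp: path_from_def)
    qed
    have Ran: "X 0 \<in> Ran" using chain by (auto simp: layered_chain_def)
    have length: "relation_length \<omega> ?S = \<omega> (card (X 0)) * (\<Sum>x\<in>I. dist x v)"
    proof -
      have "(\<Sum>x\<in>X 0. dist x (if x \<in> I then v else x)) = (\<Sum>x\<in>I. dist x v)"
        using I(3) Ran by (intro sum.mono_neutral_cong_right) (auto simp: Ran_def)
      then show ?thesis by (simp add: relation_length_graph_on)
    qed
    have merge: "is_simple_merge (X 0) (insert v (X 0 - I)) ?S"
      by (rule simple_merge_collapse[OF Ran I(3-5)])
    obtain X' R' where h: "layered_chain k X' R'" "X' 0 = insert v (X 0 - I)" "X' k = X k"
      "layered_length \<omega> k R' + \<omega> (card (X 0)) * (\<Sum>x\<in>I. dist x v) \<le> layered_length \<omega> k R"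
      using contraction by blast
    then have ?merge
      using length merge by (intro exI[of _ X'] exI[of _ R'] exI[of _ ?S]) simp
    then show ?thesis ..
  qed simp
qed

section \<open>The induction\<close>

text \<open>The order in which the two ends of the chain are extended is left open. This makes the notion
  symmetric under reversal, so that splittings can be treated as merges of the reversed chain. A
  bijection is always present; it may be the identity, which has length \<open>0\<close>.\<close>

inductive simple_MBS_length ::
    "(nat \<Rightarrow> real) \<Rightarrow> 'a::metric_space set \<Rightarrow> 'a set \<Rightarrow> real \<Rightarrow> bool" for \<omega> where
  bijection: "X \<in> Ran \<Longrightarrow> is_bijection X Y R \<Longrightarrow> simple_MBS_length \<omega> X Y (relation_length \<omega> R)"
| merge: "X \<in> Ran \<Longrightarrow> is_simple_merge X Z R \<Longrightarrow> simple_MBS_length \<omega> Z Y c \<Longrightarrow>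
    simple_MBS_length \<omega> X Y (relation_length \<omega> R + c)"
| splitting: "Y \<in> Ran \<Longrightarrow> simple_MBS_length \<omega> X Z c \<Longrightarrow> is_simple_splitting Z Y R \<Longrightarrow>
    simple_MBS_length \<omega> X Y (c + relation_length \<omega> R)"

lemma is_bijection_converse: "is_bijection X Y R \<Longrightarrow> is_bijection Y X (R\<inverse>)"
proof -
  assume "is_bijection X Y R"
  then obtain f where f: "bij_betw f X Y" "R = graph_on X f" by (auto simp: is_bijection_def)
  have "R\<inverse> = graph_on Y (inv_into X f)"
    using f by (auto simp: graph_on_def bij_betw_def image_iff f_inv_into_f inv_into_into)
  then show ?thesis using bij_betw_inv_into[OF f(1)] by (auto simp: is_bijection_def)
qed

lemma is_bijection_surjective: "is_bijection X Y R \<Longrightarrow> surjective_relation X Y R"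
  by (auto simp: is_bijection_def graph_on_def surjective_relation_def bij_betw_def)

lemma simple_MBS_length_sym: "simple_MBS_length \<omega> X Y c \<Longrightarrow> simple_MBS_length \<omega> Y X c"
proof (induction rule: simple_MBS_length.induct)
  case (bijection X Y R)
  then have "Y \<in> Ran" by (auto simp: is_bijection_def Ran_def bij_betw_def)
  then show ?case
    using simple_MBS_length.bijection[of Y X "R\<inverse>" \<omega>] is_bijection_converse[OF bijection(2)]
    by (simp add: relation_length_converse)
next
  case (merge X Z R Y c)
  then show ?case
    using simple_MBS_length.splitting[of X \<omega> Y Z c "R\<inverse>"]
    by (simp add: relation_length_converse is_simple_splitting_def add.commute)
next
  case (splitting Y X Z c R)
  then show ?case
    using simple_MBS_length.merge[of Y Z "R\<inverse>" \<omega> X c]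
    by (simp add: relation_length_converse is_simple_splitting_def add.commute)
qed

text \<open>All bijections of the chain have the same number of edges, hence the same weight, and the
  triangle inequality shows that their composition is no longer than they are together.\<close>

lemma compose_bijections:
  assumes chain: "layered_chain k X R" and w: "weight \<omega>"
    and inj: "\<And>j x x' y. j < k \<Longrightarrow> (x, y) \<in> R j \<Longrightarrow> (x', y) \<in> R j \<Longrightarrow> x = x'"
    and det: "\<And>j x y y'. j < k \<Longrightarrow> (x, y) \<in> R j \<Longrightarrow> (x, y') \<in> R j \<Longrightarrow> y = y'"
  shows "\<exists>f. bij_betw f (X 0) (X k) \<and>
    \<omega> (card (X 0)) * (\<Sum>x\<in>X 0. dist x (f x)) \<le> layered_length \<omega> k R"
  using assms
proof (induction k)
  case 0
  show ?case by (intro exI[of _ id]) (simp add: layered_length_def bij_betw_id[unfolded id_def] id_def)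
next
  case (Suc k)
  have "layered_chain k X R" using Suc.prems(1) by (simp add: layered_chain_def)
  from Suc.IH[OF this w] obtain f where f: "bij_betw f (X 0) (X k)"
    "\<omega> (card (X 0)) * (\<Sum>x\<in>X 0. dist x (f x)) \<le> layered_length \<omega> k R"
    using Suc.prems(3,4) less_SucI by (metis (no_types, lifting))
  have R: "surjective_relation (X k) (X (Suc k)) (R k)"
    using layered_chainD(1)[OF Suc.prems(1)] by simp
  then have "\<forall>x\<in>X k. \<exists>y. (x, y) \<in> R k" by (auto simp: surjective_relation_def)
  then obtain g where g: "\<forall>x\<in>X k. (x, g x) \<in> R k" by metis
  have Rg: "R k = graph_on (X k) g"
    using R g Suc.prems(4)[of k] by (auto simp: surjective_relation_def graph_on_def)
  have "inj_on g (X k)" using g Suc.prems(3)[of k] by (metis inj_onI lessI)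
  then have gb: "bij_betw g (X k) (X (Suc k))"
    using R unfolding Rg by (fastforce simp: surjective_relation_def graph_on_def bij_betw_def)
  have c: "card (X k) = card (X 0)" using bij_betw_same_card[OF f(1)] by simp
  have s: "(\<Sum>x\<in>X k. dist x (g x)) = (\<Sum>x\<in>X 0. dist (f x) (g (f x)))"
    using sum.reindex_bij_betw[OF f(1), of "\<lambda>x. dist x (g x)"] by simp
  have "1 \<le> card (X 0)"
    using Suc.prems(1) by (auto simp: layered_chain_def Ran_def Suc_le_eq card_gt_0_iff)
  then have "0 \<le> \<omega> (card (X 0))" using weight_ge_1[OF w] by fastforce
  then have "\<omega> (card (X 0)) * (\<Sum>x\<in>X 0. dist x (g (f x)))
      \<le> \<omega> (card (X 0)) * ((\<Sum>x\<in>X 0. dist x (f x)) + (\<Sum>x\<in>X 0. dist (f x) (g (f x))))"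
    unfolding sum.distrib[symmetric] by (intro mult_left_mono sum_mono dist_triangle)
  also have "\<dots> \<le> layered_length \<omega> (Suc k) R"
    using f(2) c s by (simp add: layered_length_def Rg relation_length_graph_on distrib_left)
  finally show ?case
    using bij_betw_trans[OF f(1) gb] by (intro exI[of _ "\<lambda>x. g (f x)"]) (simp add: comp_def)
qed

text \<open>Deleting a detour keeps both ends of the chain and removes an edge; extracting a merge shrinks
  the initial configuration. The cardinalities of the ends therefore come first in the measure. Both
  components are invariant under reversal, so that the reversed chain may replace the given one.\<close>

lemma layered_chain_ge_simple_MBS_length:
  fixes X :: "nat \<Rightarrow> 'a::metric_space set"
  assumes "layered_chain k X R" "weight \<omega>"
  shows "\<exists>c \<le> layered_length \<omega> k R. simple_MBS_length \<omega> (X 0) (X k) c"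
  using assms(1)
proof (induction "(card (X 0) + card (X k), edge_count k R)" arbitrary: k X R
    rule: wf_induct_rule[OF wf_lex_prod[OF wf_less_than wf_less_than]])
  case (1 k X R)
  note w = assms(2)
  have IH: "\<exists>c \<le> layered_length \<omega> k' R'. simple_MBS_length \<omega> (X' 0) (X' k') c"
    if "layered_chain k' X' R'"
      "card (X' 0) + card (X' k') < card (X 0) + card (X k) \<or>
       card (X' 0) + card (X' k') = card (X 0) + card (X k) \<and> edge_count k' R' < edge_count k R"
    for k' R' and X' :: "nat \<Rightarrow> 'a set"
    using 1(1) that by (simp add: in_lex_prod)
  have main: "\<exists>c \<le> layered_length \<omega> k' R'. simple_MBS_length \<omega> (X' 0) (X' k') c"
    if chain': "layered_chain k' X' R'"
      and same: "card (X' 0) + card (X' k') = card (X 0) + card (X k)" "edge_count k' R' = edge_count k R"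
      and meet: "j < k'" "(a, v) \<in> R' j" "(b, v) \<in> R' j" "a \<noteq> b" for k' R' j a b v and X' :: "nat \<Rightarrow> 'a set"
    using delete_detour_or_extract_merge[OF chain' w meet]
  proof (elim disjE exE conjE)
    fix X'' R'' assume h: "layered_chain k' X'' R''" "X'' 0 = X' 0" "X'' k' = X' k'"
      "layered_length \<omega> k' R'' \<le> layered_length \<omega> k' R'" "edge_count k' R'' < edge_count k' R'"
    then obtain c where "c \<le> layered_length \<omega> k' R''" "simple_MBS_length \<omega> (X'' 0) (X'' k') c"
      using IH[OF h(1)] same by auto
    then show ?thesis using h by (intro exI[of _ c]) auto
  next
    fix X'' R'' S assume h: "layered_chain k' X'' R''" "is_simple_merge (X' 0) (X'' 0) S" "X'' k' = X' k'"
      "relation_length \<omega> S + layered_length \<omega> k' R'' \<le> layered_length \<omega> k' R'"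
    have X': "X' 0 \<in> Ran" using chain' by (simp add: layered_chain_def)
    then have "card (X'' 0) < card (X' 0)"
      using is_merge_card_less[OF is_simple_merge_imp_merge[OF h(2)]] by (simp add: Ran_def)
    then obtain c where c: "c \<le> layered_length \<omega> k' R''" "simple_MBS_length \<omega> (X'' 0) (X'' k') c"
      using IH[OF h(1)] same h(3) by auto
    have "simple_MBS_length \<omega> (X' 0) (X' k') (relation_length \<omega> S + c)"
      using simple_MBS_length.merge[OF X' h(2) c(2)] h(3) by simp
    then show ?thesis using h(4) c(1) by (intro exI[of _ "relation_length \<omega> S + c"]) auto
  qed
  show ?case
  proof (cases "\<exists>j<k. \<exists>a b v. (a, v) \<in> R j \<and> (b, v) \<in> R j \<and> a \<noteq> b")
    case True
    then show ?thesis using main[OF 1(2)] by blast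
  next
    case no_meet: False
    show ?thesis
    proof (cases "\<exists>j<k. \<exists>a b v. (v, a) \<in> R j \<and> (v, b) \<in> R j \<and> a \<noteq> b")
      case True
      then obtain j a b v where h: "j < k" "(v, a) \<in> R j" "(v, b) \<in> R j" "a \<noteq> b" by blast
      note rev = layered_chain_reverse[OF 1(2)]
      have "\<exists>c \<le> layered_length \<omega> k (\<lambda>j. (R (k - Suc j))\<inverse>).
          simple_MBS_length \<omega> (X (k - 0)) (X (k - k)) c"
        using main[OF rev(1) _ rev(3), of "k - Suc j" a v b] h by auto
      then show ?thesis using rev(2)[of \<omega>] simple_MBS_length_sym[of \<omega> "X k" "X 0"] by auto
    next
      case False
      obtain f where f: "bij_betw f (X 0) (X k)"
        "\<omega> (card (X 0)) * (\<Sum>x\<in>X 0. dist x (f x)) \<le> layered_length \<omega> k R"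
        using compose_bijections[OF 1(2) w] no_meet False by metis
      have "X 0 \<in> Ran" "is_bijection (X 0) (X k) (graph_on (X 0) f)"
        using 1(2) f(1) by (auto simp: layered_chain_def is_bijection_def)
      from simple_MBS_length.bijection[OF this] show ?thesis
        using f(2) relation_length_graph_on by metis
    qed
  qed
qed

section \<open>Simple MBS-chains as lists\<close>

lemma chain_length_Cons: "chain_length \<omega> (R # Rs) = relation_length \<omega> R + chain_length \<omega> Rs"
  unfolding chain_length_def by (simp add: sum.lessThan_Suc_shift del: sum.lessThan_Suc)

lemma chain_length_snoc: "chain_length \<omega> (Rs @ [R]) = chain_length \<omega> Rs + relation_length \<omega> R"
  unfolding chain_length_def by (simp add: nth_append)

text \<open>Simplicity also asks that a relation which happens to be a merge be simple, wherever it occurs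
  in the chain. Merges decrease, splittings increase, and bijections preserve the cardinality, so
  that no relation has two of these kinds.\<close>

lemma simple_MBS_chainI:
  assumes c: "combinatorial_chain X Y Xs Rs" "l < length Rs"
    and m: "\<forall>i<l. is_simple_merge (Xs ! i) (Xs ! Suc i) (Rs ! i)"
    and b: "is_bijection (Xs ! l) (Xs ! Suc l) (Rs ! l)"
    and s: "\<forall>i. l < i \<and> i < length Rs \<longrightarrow> is_simple_splitting (Xs ! i) (Xs ! Suc i) (Rs ! i)"
  shows "simple_MBS_chain X Y Xs Rs"
proof -
  have "MBS_chain X Y Xs Rs"
    unfolding MBS_chain_def is_splitting_def
    using c m b s is_simple_merge_imp_merge unfolding is_simple_splitting_def by blast
  moreover have
    "(is_merge (Xs ! i) (Xs ! Suc i) (Rs ! i) \<longrightarrow> is_simple_merge (Xs ! i) (Xs ! Suc i) (Rs ! i)) \<and>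
     (is_splitting (Xs ! i) (Xs ! Suc i) (Rs ! i) \<longrightarrow>
        is_simple_splitting (Xs ! i) (Xs ! Suc i) (Rs ! i))" if i: "i < length Rs" for i
  proof -
    let ?A = "Xs ! i" and ?B = "Xs ! Suc i" and ?R = "Rs ! i"
    have "finite ?A" "finite ?B"
      using c(1) i by (auto simp: combinatorial_chain_def Ran_def subset_eq)
    then have decrease: "is_merge ?A ?B ?R \<Longrightarrow> card ?B < card ?A"
      and increase: "is_splitting ?A ?B ?R \<Longrightarrow> card ?A < card ?B"
      using is_merge_card_less is_splitting_def by metis+
    have "is_simple_merge ?A ?B ?R \<or> is_bijection ?A ?B ?R \<or> is_simple_splitting ?A ?B ?R"
      using m b s i by (metis linorder_neqE_nat)
    moreover have "is_bijection ?A ?B ?R \<Longrightarrow> card ?A = card ?B"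
      by (auto simp: is_bijection_def bij_betw_same_card)
    moreover have "is_simple_splitting ?A ?B ?R \<Longrightarrow> is_splitting ?A ?B ?R"
      unfolding is_simple_splitting_def is_splitting_def by (rule is_simple_merge_imp_merge)
    ultimately show ?thesis
      using decrease increase is_simple_merge_imp_merge[of ?A ?B ?R] by linarith
  qed
  ultimately show ?thesis unfolding simple_MBS_chain_def by blast
qed

lemma simple_MBS_length_imp_chain:
  assumes "simple_MBS_length \<omega> X Y c"
  shows "\<exists>Xs Rs. simple_MBS_chain X Y Xs Rs \<and> chain_length \<omega> Rs = c"
proof -
  have "\<exists>Xs Rs l. combinatorial_chain X Y Xs Rs \<and> chain_length \<omega> Rs = c \<and> l < length Rs \<and>
    (\<forall>i<l. is_simple_merge (Xs ! i) (Xs ! Suc i) (Rs ! i)) \<and>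
    is_bijection (Xs ! l) (Xs ! Suc l) (Rs ! l) \<and>
    (\<forall>i. l < i \<and> i < length Rs \<longrightarrow> is_simple_splitting (Xs ! i) (Xs ! Suc i) (Rs ! i))"
    using assms
  proof (induction rule: simple_MBS_length.induct)
    case (bijection X Y R)
    then have "Y \<in> Ran" by (auto simp: is_bijection_def Ran_def bij_betw_def)
    then show ?case
      using bijection is_bijection_surjective
      by (intro exI[of _ "[X, Y]"] exI[of _ "[R]"] exI[of _ 0])
         (auto simp: combinatorial_chain_def chain_length_def)
  next
    case (merge X Z R Y c)
    then obtain Xs Rs l where h: "combinatorial_chain Z Y Xs Rs" "chain_length \<omega> Rs = c" "l < length Rs"
      "\<forall>i<l. is_simple_merge (Xs ! i) (Xs ! Suc i) (Rs ! i)"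
      "is_bijection (Xs ! l) (Xs ! Suc l) (Rs ! l)"
      "\<forall>i. l < i \<and> i < length Rs \<longrightarrow> is_simple_splitting (Xs ! i) (Xs ! Suc i) (Rs ! i)" by blast
    have "surjective_relation X Z R"
      using merge is_merge_imp_surjective is_simple_merge_imp_merge by blast
    then have "combinatorial_chain X Y (X # Xs) (R # Rs)"
      using combinatorial_chain_Cons h(1) merge by blast
    moreover have "Xs ! 0 = Z" using h(1) by (simp add: combinatorial_chain_def)
    ultimately show ?case
      using h(2-) merge
      by (intro exI[of _ "X # Xs"] exI[of _ "R # Rs"] exI[of _ "Suc l"])
         (auto simp: chain_length_Cons nth_Cons split: nat.splits)
  next
    case (splitting Y X Z c R)
    then obtain Xs Rs l where h: "combinatorial_chain X Z Xs Rs" "chain_length \<omega> Rs = c" "l < length Rs"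
      "\<forall>i<l. is_simple_merge (Xs ! i) (Xs ! Suc i) (Rs ! i)"
      "is_bijection (Xs ! l) (Xs ! Suc l) (Rs ! l)"
      "\<forall>i. l < i \<and> i < length Rs \<longrightarrow> is_simple_splitting (Xs ! i) (Xs ! Suc i) (Rs ! i)" by blast
    have "surjective_relation Z Y R"
      using splitting by (meson is_merge_imp_surjective is_simple_merge_imp_merge
          is_simple_splitting_def surjective_relation_converse)
    then have "combinatorial_chain X Y (Xs @ [Y]) (Rs @ [R])"
      using combinatorial_chain_snoc h(1) splitting by blast
    moreover have "length Xs = Suc (length Rs)" "Xs ! length Rs = Z"
      using h(1) by (auto simp: combinatorial_chain_def)
    ultimately show ?case
      using h(2-) splitting
      by (intro exI[of _ "Xs @ [Y]"] exI[of _ "Rs @ [R]"] exI[of _ l])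
         (auto simp: chain_length_snoc nth_append less_Suc_eq)
  qed
  then show ?thesis using simple_MBS_chainI by blast
qed

lemma combinatorial_chain_ge_simple_MBS_chain:
  assumes "combinatorial_chain X Y Xs Rs" "weight \<omega>"
  shows "\<exists>Xs' Rs'. simple_MBS_chain X Y Xs' Rs' \<and> chain_length \<omega> Rs' \<le> chain_length \<omega> Rs"
proof -
  have "layered_chain (length Rs) ((!) Xs) ((!) Rs)"
    using assms(1) by (auto simp: combinatorial_chain_def layered_chain_def subset_eq)
  from layered_chain_ge_simple_MBS_length[OF this assms(2)] obtain c
    where "c \<le> chain_length \<omega> Rs" "simple_MBS_length \<omega> X Y c"
    using assms(1) by (auto simp: layered_length_def chain_length_def combinatorial_chain_def)
  then show ?thesis using simple_MBS_length_imp_chain by blast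
qed

theorem theorem2p16:
  fixes X Y :: "'a::metric_space set" and \<omega> :: "nat \<Rightarrow> real"
  assumes "X \<in> Ran" and "Y \<in> Ran" and "weight \<omega>"
  shows "weighted_distance \<omega> X Y =
    Inf {chain_length \<omega> Rs | Xs Rs. simple_MBS_chain X Y Xs Rs}"
  unfolding weighted_distance_def
proof (rule antisym)
  note inf = chain_lengths_nonempty_bdd_below[OF assms]
  show "Inf {chain_length \<omega> Rs | Xs Rs. combinatorial_chain X Y Xs Rs}
    \<le> Inf {chain_length \<omega> Rs | Xs Rs. simple_MBS_chain X Y Xs Rs}"
    by (rule cInf_superset_mono[OF inf(3,2)]) (auto simp: simple_MBS_chain_def MBS_chain_def)
  show "Inf {chain_length \<omega> Rs | Xs Rs. simple_MBS_chain X Y Xs Rs}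
    \<le> Inf {chain_length \<omega> Rs | Xs Rs. combinatorial_chain X Y Xs Rs}"
  proof (rule cInf_mono[OF inf(1,4)])
    fix c assume "c \<in> {chain_length \<omega> Rs | Xs Rs. combinatorial_chain X Y Xs Rs}"
    then show "\<exists>c'\<in>{chain_length \<omega> Rs | Xs Rs. simple_MBS_chain X Y Xs Rs}. c' \<le> c"
      using combinatorial_chain_ge_simple_MBS_chain[OF _ assms(3)] by blast
  qed
qed

end
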